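(* Let $G$ be a finitely generated solvable group such that its commutator subgroup $[G,G]$ is finitely generated and nilpotent. Then the commutator subgroup $[G,G]$ is bounded in $G$. Consequently, $G$ satisfies the bq-dichotomy.
   Context: For a group $G$ and a finite symmetric set $S\subset G$ such that the set $\overline S$ of conjugates of elements of $S$ generates $G$ (such $G$ is called normally finitely generated), the biinvariant word norm is $\|g\|=\min\{k\ge0 : g=s_1\cdots s_k,\ s_i\in\overline S\}$ (well defined up to Lipschitz equivalence). A subgroup $H\subset G$ is bounded in $G$ if $\sup_{h\in H}\|h\|<\infty$. A homogeneous quasimorphism on $G$ is a function $q\colon G\to\mathbb{R}$ with $\sup_{g,h}|q(gh)-q(g)-q(h)|<\infty$ and $q(g^n)=nq(g)$ for all $g\in G$, $n\in\mathbb{Z}$. A normally finitely generated group $G$ satisfies the bq-dichotomy if for every $g\in G$ either $\langle g\rangle$ is bounded in $G$ or there is a homogeneous quasimorphism $q$ on $G$ with $q(g)\neq0$. *)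

theory Defs
  imports "HOL-Algebra.Algebra" Complex_Main
begin

definition finitely_generated_group :: "('a, 'b) monoid_scheme \<Rightarrow> bool" where
  "finitely_generated_group G \<longleftrightarrow>
     group G \<and> (\<exists>A. finite A \<and> A \<subseteq> carrier G \<and> generate G A = carrier G)"

definition mixed_commutator ::
    "('a, 'b) monoid_scheme \<Rightarrow> 'a set \<Rightarrow> 'a set \<Rightarrow> 'a set" where
  "mixed_commutator G H K =
     generate G {h \<otimes>\<^bsub>G\<^esub> k \<otimes>\<^bsub>G\<^esub> inv\<^bsub>G\<^esub> h \<otimes>\<^bsub>G\<^esub> inv\<^bsub>G\<^esub> k | h k. h \<in> H \<and> k \<in> K}"

fun lower_central_series :: "('a, 'b) monoid_scheme \<Rightarrow> nat \<Rightarrow> 'a set" where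
  "lower_central_series G 0 = carrier G"
| "lower_central_series G (Suc n) = mixed_commutator G (lower_central_series G n) (carrier G)"

definition nilpotent_group :: "('a, 'b) monoid_scheme \<Rightarrow> bool" where
  "nilpotent_group G \<longleftrightarrow> group G \<and> (\<exists>n. lower_central_series G n = {\<one>\<^bsub>G\<^esub>})"

definition conjugates :: "('a, 'b) monoid_scheme \<Rightarrow> 'a set \<Rightarrow> 'a set" where
  "conjugates G S = {g \<otimes>\<^bsub>G\<^esub> s \<otimes>\<^bsub>G\<^esub> inv\<^bsub>G\<^esub> g | g s. g \<in> carrier G \<and> s \<in> S}"

definition normal_generating_set :: "('a, 'b) monoid_scheme \<Rightarrow> 'a set \<Rightarrow> bool" where
  "normal_generating_set G S \<longleftrightarrow>
     finite S \<and> S \<subseteq> carrier G \<and> (\<forall>s\<in>S. inv\<^bsub>G\<^esub> s \<in> S) \<and>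
     generate G (conjugates G S) = carrier G"

definition normally_finitely_generated :: "('a, 'b) monoid_scheme \<Rightarrow> bool" where
  "normally_finitely_generated G \<longleftrightarrow> group G \<and> (\<exists>S. normal_generating_set G S)"

text \<open>The minimum is over a nonempty set for every \<open>g\<close> in the carrier as soon as
  \<open>normal_generating_set G S\<close> holds; it is only used under that hypothesis.\<close>

definition word_norm :: "('a, 'b) monoid_scheme \<Rightarrow> 'a set \<Rightarrow> 'a \<Rightarrow> nat" where
  "word_norm G S g =
     (LEAST k. \<exists>ss. length ss = k \<and> set ss \<subseteq> conjugates G S \<and>
                    g = foldr (\<otimes>\<^bsub>G\<^esub>) ss \<one>\<^bsub>G\<^esub>)"

text \<open>Norms for different choices of \<open>S\<close> are Lipschitz equivalent, so boundedness does not
  depend on \<open>S\<close>; it is required here for all admissible \<open>S\<close>, of which there is at least one.\<close>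

definition bounded_subgroup :: "('a, 'b) monoid_scheme \<Rightarrow> 'a set \<Rightarrow> bool" where
  "bounded_subgroup G H \<longleftrightarrow>
     normally_finitely_generated G \<and> subgroup H G \<and>
     (\<forall>S. normal_generating_set G S \<longrightarrow> bdd_above (word_norm G S ` H))"

definition homogeneous_quasimorphism ::
    "('a, 'b) monoid_scheme \<Rightarrow> ('a \<Rightarrow> real) \<Rightarrow> bool" where
  "homogeneous_quasimorphism G q \<longleftrightarrow>
     (\<exists>D. \<forall>g\<in>carrier G. \<forall>h\<in>carrier G. \<bar>q (g \<otimes>\<^bsub>G\<^esub> h) - q g - q h\<bar> \<le> D) \<and>
     (\<forall>g\<in>carrier G. \<forall>n::int. q (g [^]\<^bsub>G\<^esub> n) = of_int n * q g)"

definition bq_dichotomy :: "('a, 'b) monoid_scheme \<Rightarrow> bool" where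
  "bq_dichotomy G \<longleftrightarrow>
     normally_finitely_generated G \<and>
     (\<forall>g\<in>carrier G. bounded_subgroup G (generate G {g}) \<or>
        (\<exists>q. homogeneous_quasimorphism G q \<and> q g \<noteq> 0))"

end

theory Submission
  imports Defs
begin

text \<open>
  Write \<open>[x, y]\<close> for \<open>x y x\<inverse> y\<inverse>\<close> and \<open>N = [G, G]\<close>.  The source of all boundedness is that, for a fixed
  element \<open>a\<close>, the commutators \<open>[m, a] = (m a m\<inverse>) a\<inverse>\<close> have norm at most \<open>\<parallel>a\<parallel> + \<parallel>a\<inverse>\<parallel>\<close>,
  whatever \<open>m\<close> is, because the norm does not increase under conjugation.  The problem is to write
  every element of \<open>N\<close> as a product of a fixed number of commutators against elements of a finite set.

  This is possible one layer of a series at a time.  Let \<open>Q\<close> be generated by a finite set \<open>A\<close>,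
  and let \<open>L \<subseteq> K \<subseteq> M\<close> be subgroups with \<open>[M, Q] \<subseteq> K\<close> and \<open>[M, K] \<subseteq> L\<close>.  Modulo \<open>L\<close> the group \<open>K\<close>
  is central in \<open>M\<close>, so for each \<open>a \<in> A\<close> the map \<open>m \<mapsto> [m, a]\<close> from \<open>M\<close> to \<open>K/L\<close> is a homomorphism.
  The product of its images, over all \<open>a \<in> A\<close>, is therefore a subgroup modulo \<open>L\<close>, each of whose
  elements is a product of \<open>card A\<close> commutators.  This subgroup contains
  \<open>[m, a]\<close> for all \<open>m \<in> M\<close>, \<open>a \<in> A\<close>, and then also \<open>[m, q]\<close> for all \<open>q \<in> Q\<close>.  Hence if \<open>L\<close> is bounded, so is
  \<open>[M, Q]\<close> (lemma \<open>norm_bounded_mixed_commutator\<close>).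

  This is applied in three situations.  Let \<open>\<gamma>\<^sub>0 = N\<close> and \<open>\<gamma>\<^sub>i\<^sub>+\<^sub>1 = [\<gamma>\<^sub>i, N]\<close> be the
  lower central series of \<open>N\<close>.
  \<^item> \<open>Q = N\<close>, \<open>M = \<gamma>\<^sub>i\<close>, \<open>K = \<gamma>\<^sub>i\<^sub>+\<^sub>1\<close>, \<open>L = \<gamma>\<^sub>i\<^sub>+\<^sub>2\<close>: as \<open>N\<close> is finitely generated,
    boundedness climbs the series from its trivial end up to \<open>\<gamma>\<^sub>1 = [N, N]\<close>.
  \<^item> \<open>Q = G\<close>, \<open>M = K = N\<close>, \<open>L = [N, N]\<close>: this gives boundedness of \<open>[N, G]\<close>.
  \<^item> \<open>Q = M = G\<close>, \<open>K = N\<close>, \<open>L = [N, G]\<close>: this gives boundedness of \<open>[G, G] = N\<close>.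

  For the dichotomy, if a nonzero power of \<open>g\<close> lies in \<open>N\<close>, then the cyclic group of \<open>g\<close> lies in finitely many cosets of
  the bounded group \<open>N\<close>, so it is bounded.  Otherwise \<open>g\<close> has infinite order in the finitely generated abelian group
  \<open>G/N\<close>, and the homomorphism to \<open>\<real>\<close> with value 0 on \<open>N\<close> and 1 at \<open>g\<close> extends to \<open>G\<close> one generator at a time,
  because \<open>\<real>\<close> is divisible (lemma \<open>exists_additive_nonzero\<close>).  A homomorphism to \<open>\<real>\<close> is a
  homogeneous quasimorphism.
\<close>

section \<open>Words and commutators\<close>

text \<open>
  Together with \<open>m_assoc\<close> and \<open>inv_mult_group\<close>, these two cancellations make simplification compute reduced words
  in a free group, so that commutator identities become automatic.
\<close>

lemma (in group) inv_mult_cancel [simp]: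
  assumes "x \<in> carrier G" "y \<in> carrier G"
  shows "inv x \<otimes> (x \<otimes> y) = y" "x \<otimes> (inv x \<otimes> y) = y"
  using assms by (simp_all flip: m_assoc)

lemmas (in group) word_simps = m_assoc inv_mult_group

abbreviation (in group) commutator :: "'a \<Rightarrow> 'a \<Rightarrow> 'a"
  where "commutator x y \<equiv> x \<otimes> y \<otimes> inv x \<otimes> inv y"

lemma (in group) commutator_mult_left:
  assumes "x \<in> carrier G" "y \<in> carrier G" "a \<in> carrier G"
  shows "commutator (x \<otimes> y) a
    = commutator x (commutator y a) \<otimes> commutator y a \<otimes> commutator x a"
  using assms by (simp add: word_simps)

text \<open>
  The middle factor is again the inverse of a commutator with \<open>a\<close>, now of the element \<open>[x, b]\<close>.
  Thus the right-hand side involves only commutators whose second argument is \<open>a\<close> or \<open>b\<close>, which is what an induction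
  over words in the second argument needs.
\<close>

lemma (in group) commutator_mult_right:
  assumes "x \<in> carrier G" "a \<in> carrier G" "b \<in> carrier G"
  shows "commutator x (a \<otimes> b)
    = commutator x a \<otimes> inv (commutator (commutator x b) a) \<otimes> commutator x b"
  using assms by (simp add: word_simps)

lemma (in group) commutator_inv_right:
  assumes "x \<in> carrier G" "a \<in> carrier G"
  shows "commutator x (inv a) = inv (commutator (inv a \<otimes> x \<otimes> a) a)"
  using assms by (simp add: word_simps)

text \<open>
  If \<open>P\<close> were normal in \<open>G\<close>, this would say that the preimage in \<open>G\<close> of the image of a homomorphism
  \<open>B \<rightarrow> G/P\<close> is a subgroup.  It suffices that the values of \<open>f\<close> conjugate \<open>P\<close> into itself.
  The lemma serves for \<open>m \<mapsto> [m, a]\<close>, a homomorphism only modulo \<open>P\<close>, and for \<open>n \<mapsto> a\<^sup>n\<close> on the integers.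
\<close>

lemma (in group) subgroup_hom_mod_image:
  assumes P: "subgroup P G" and M: "group B"
    and f: "\<And>x. x \<in> carrier B \<Longrightarrow> f x \<in> carrier G"
    and normalises: "\<And>x p. x \<in> carrier B \<Longrightarrow> p \<in> P \<Longrightarrow> f x \<otimes> p \<otimes> inv (f x) \<in> P"
    and hom_mod: "\<And>x y. x \<in> carrier B \<Longrightarrow> y \<in> carrier B \<Longrightarrow>
                    f x \<otimes> f y \<otimes> inv (f (x \<otimes>\<^bsub>B\<^esub> y)) \<in> P"
  shows "subgroup {p \<otimes> f x | p x. p \<in> P \<and> x \<in> carrier B} G" (is "subgroup ?R G")
proof -
  interpret B: group B by (fact M)
  interpret P: subgroup P G by (fact P)
  have f1: "f \<one>\<^bsub>B\<^esub> \<in> P"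
    using hom_mod[of "\<one>\<^bsub>B\<^esub>" "\<one>\<^bsub>B\<^esub>"] f by (simp add: word_simps)
  show ?thesis
  proof (rule subgroupI)
    show "?R \<subseteq> carrier G" using f by auto
    show "?R \<noteq> {}" using P.one_closed B.one_closed by blast
  next
    \<comment> \<open>Normalisation is assumed for values of \<open>f\<close>, not for their inverses, so the inverse of \<open>f x\<close> is replaced by
      \<open>f\<close> at the inverse of \<open>x\<close>, which agrees with it up to a factor in \<open>P\<close>.\<close>
    fix g assume "g \<in> ?R"
    then obtain p x where p: "p \<in> P" and x: "x \<in> carrier B" and g: "g = p \<otimes> f x" by auto
    define y where "y = inv\<^bsub>B\<^esub> x"
    have y: "y \<in> carrier B" and yx: "y \<otimes>\<^bsub>B\<^esub> x = \<one>\<^bsub>B\<^esub>" using x by (auto simp: y_def)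
    have "f y \<otimes> f x \<otimes> inv (f \<one>\<^bsub>B\<^esub>) \<otimes> f \<one>\<^bsub>B\<^esub> \<in> P"
      using hom_mod[OF y x] f1 yx by simp
    then have w: "f y \<otimes> f x \<in> P" using f x y f1 by (simp add: word_simps)
    have "inv g = inv (f y \<otimes> f x) \<otimes> (f y \<otimes> inv p \<otimes> inv (f y)) \<otimes> f y"
      using f x y p g by (simp add: word_simps)
    moreover have "inv (f y \<otimes> f x) \<otimes> (f y \<otimes> inv p \<otimes> inv (f y)) \<in> P"
      using w normalises[OF y, of "inv p"] p by auto
    ultimately show "inv g \<in> ?R" using y by blast
  next
    fix g g' assume "g \<in> ?R" "g' \<in> ?R"
    then obtain p x p' y where p: "p \<in> P" "p' \<in> P" and x: "x \<in> carrier B" "y \<in> carrier B"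
      and g: "g = p \<otimes> f x" "g' = p' \<otimes> f y" by auto
    have xy: "x \<otimes>\<^bsub>B\<^esub> y \<in> carrier B" using x by simp
    have "g \<otimes> g' = p \<otimes> (f x \<otimes> p' \<otimes> inv (f x)) \<otimes> (f x \<otimes> f y \<otimes> inv (f (x \<otimes>\<^bsub>B\<^esub> y)))
                     \<otimes> f (x \<otimes>\<^bsub>B\<^esub> y)"
      using f[OF x(1)] f[OF x(2)] f[OF xy] p g by (simp add: word_simps)
    moreover have "p \<otimes> (f x \<otimes> p' \<otimes> inv (f x)) \<otimes> (f x \<otimes> f y \<otimes> inv (f (x \<otimes>\<^bsub>B\<^esub> y))) \<in> P"
      using p normalises[OF x(1) p(2)] hom_mod[OF x] by auto
    ultimately show "g \<otimes> g' \<in> ?R" using xy by blast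
  qed
qed

text \<open>
  The generated subgroup may fail to normalise \<open>P\<close>, so the commutators cannot be treated one \<open>m\<close> at a time.
  Instead, the induction over words runs simultaneously for all \<open>m \<in> M\<close>: the identities for \<open>[m, a b]\<close> and
  \<open>[m, a\<inverse>]\<close> only introduce commutators of other elements of \<open>M\<close>.
\<close>

lemma (in group) commutators_in_subgroup_generators:
  assumes P: "subgroup P G" and M: "subgroup M G" and A: "A \<subseteq> carrier G"
    and K: "K \<subseteq> M"
    and MQ: "\<And>m q. m \<in> M \<Longrightarrow> q \<in> generate G A \<Longrightarrow> commutator m q \<in> K"
    and MA: "\<And>m a. m \<in> M \<Longrightarrow> a \<in> A \<Longrightarrow> commutator m a \<in> P"
    and b: "b \<in> generate G A" and m: "m \<in> M"
  shows "commutator m b \<in> P"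
proof -
  interpret P: subgroup P G by (fact P)
  interpret M: subgroup M G by (fact M)
  have car: "q \<in> carrier G" if "q \<in> generate G A" for q
    using generate_in_carrier[OF A that] .
  show ?thesis
    using b m
  proof (induction b arbitrary: m rule: generate.induct)
    case one
    then show ?case by simp
  next
    case (incl a)
    then show ?case using MA by blast
  next
    case (inv a)
    have a: "a \<in> carrier G" "m \<in> carrier G" using inv A by auto
    \<comment> \<open>\<open>M\<close> is closed under conjugation by \<open>a\<inverse>\<close>, since it contains its commutators with \<open>a\<inverse>\<close>.\<close>
    have "commutator m (inv a) \<in> M"
      using MQ[OF inv.prems generate.inv[OF inv.hyps]] K by blast
    then have "inv m \<otimes> commutator m (inv a) \<in> M" using inv.prems by blast
    moreover have "inv m \<otimes> commutator m (inv a) = inv a \<otimes> inv m \<otimes> a"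
      using a by (simp add: word_simps)
    ultimately have "inv (inv a \<otimes> inv m \<otimes> a) \<in> M" by (metis M.m_inv_closed)
    then have "inv a \<otimes> m \<otimes> a \<in> M" using a by (simp add: word_simps)
    then show ?case
      using commutator_inv_right[of m a] a MA[of "inv a \<otimes> m \<otimes> a" a] inv.hyps by auto
  next
    case (eng a b)
    have k: "commutator m b \<in> M" using MQ[OF eng.prems eng.hyps(2)] K by blast
    show ?case
      using eng.IH(1)[OF eng.prems] eng.IH(2)[OF eng.prems] eng.IH(1)[OF k]
        commutator_mult_right[of m a b] car[OF eng.hyps(1)] car[OF eng.hyps(2)] eng.prems
      by auto
  qed
qed


section \<open>The word norm\<close>

locale word_normed_group = group +
  fixes S
  assumes normal_generating_set: "normal_generating_set G S"
begin

abbreviation norm_bounded :: "'a set \<Rightarrow> bool"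
  where "norm_bounded U \<equiv> bdd_above (word_norm G S ` U)"

lemma S_carrier: "S \<subseteq> carrier G"
  using normal_generating_set by (simp add: normal_generating_set_def)

lemma conjugates_carrier: "conjugates G S \<subseteq> carrier G"
  using S_carrier by (auto simp: conjugates_def)

lemma conjugates_inv:
  assumes "c \<in> conjugates G S"
  shows "inv c \<in> conjugates G S"
proof -
  obtain g s where "g \<in> carrier G" "s \<in> S" "c = g \<otimes> s \<otimes> inv g"
    using assms by (auto simp: conjugates_def)
  moreover from this have "inv c = g \<otimes> inv s \<otimes> inv g"
    using S_carrier by (auto simp: word_simps)
  ultimately show ?thesis
    using normal_generating_set unfolding conjugates_def normal_generating_set_def by blast
qed

lemma conjugates_conj:
  assumes "c \<in> conjugates G S" "h \<in> carrier G"
  shows "h \<otimes> c \<otimes> inv h \<in> conjugates G S"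
proof -
  obtain g s where gs: "g \<in> carrier G" "s \<in> S" "c = g \<otimes> s \<otimes> inv g"
    using assms by (auto simp: conjugates_def)
  then have "h \<otimes> c \<otimes> inv h = (h \<otimes> g) \<otimes> s \<otimes> inv (h \<otimes> g)"
    using S_carrier assms by (auto simp: word_simps)
  then show ?thesis
    using gs assms unfolding conjugates_def by blast
qed

lemma foldr_closed:
  "set ss \<subseteq> carrier G \<Longrightarrow> foldr (\<otimes>) ss \<one> \<in> carrier G"
  by (induction ss) auto

lemma foldr_append_mult:
  "set xs \<subseteq> carrier G \<Longrightarrow> set ys \<subseteq> carrier G \<Longrightarrow>
   foldr (\<otimes>) (xs @ ys) \<one> = foldr (\<otimes>) xs \<one> \<otimes> foldr (\<otimes>) ys \<one>"
  using foldr_closed[of ys] by (induction xs) (auto simp: m_assoc foldr_closed)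

lemma foldr_conj:
  "set xs \<subseteq> carrier G \<Longrightarrow> h \<in> carrier G \<Longrightarrow>
   foldr (\<otimes>) (map (\<lambda>c. h \<otimes> c \<otimes> inv h) xs) \<one> = h \<otimes> foldr (\<otimes>) xs \<one> \<otimes> inv h"
  by (induction xs) (auto simp: word_simps foldr_closed)

lemma word_exists:
  assumes "g \<in> carrier G"
  shows "\<exists>ss. set ss \<subseteq> conjugates G S \<and> g = foldr (\<otimes>) ss \<one>"
proof -
  have "g \<in> generate G (conjugates G S)"
    using assms normal_generating_set by (simp add: normal_generating_set_def)
  then show ?thesis
  proof (induction rule: generate.induct)
    case one
    show ?case by (rule exI[of _ "[]"]) simp
  next
    case (incl h)
    then show ?case using conjugates_carrier by (intro exI[of _ "[h]"]) auto
  next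
    case (inv h)
    then show ?case
      using conjugates_carrier conjugates_inv by (intro exI[of _ "[inv h]"]) auto
  next
    case (eng g h)
    then obtain xs ys where "set xs \<subseteq> conjugates G S" "g = foldr (\<otimes>) xs \<one>"
      "set ys \<subseteq> conjugates G S" "h = foldr (\<otimes>) ys \<one>" by blast
    then show ?case
      using conjugates_carrier foldr_append_mult[of xs ys]
      by (intro exI[of _ "xs @ ys"]) auto
  qed
qed

lemma word_norm_attained:
  assumes "g \<in> carrier G"
  obtains ss where "length ss = word_norm G S g" "set ss \<subseteq> conjugates G S"
    "g = foldr (\<otimes>) ss \<one>"
proof -
  have "\<exists>k ss. length ss = k \<and> set ss \<subseteq> conjugates G S \<and> g = foldr (\<otimes>) ss \<one>"
    using word_exists[OF assms] by blast
  from LeastI_ex[OF this] show ?thesis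
    using that unfolding word_norm_def by blast
qed

lemma word_norm_le:
  assumes "set ss \<subseteq> conjugates G S"
  shows "word_norm G S (foldr (\<otimes>) ss \<one>) \<le> length ss"
  unfolding word_norm_def using assms by (intro Least_le) blast

lemma word_norm_mult:
  assumes "g \<in> carrier G" "h \<in> carrier G"
  shows "word_norm G S (g \<otimes> h) \<le> word_norm G S g + word_norm G S h"
proof -
  obtain xs ys where "length xs = word_norm G S g" "set xs \<subseteq> conjugates G S"
    "g = foldr (\<otimes>) xs \<one>" "length ys = word_norm G S h" "set ys \<subseteq> conjugates G S"
    "h = foldr (\<otimes>) ys \<one>"
    using word_norm_attained assms by metis
  then show ?thesis
    using word_norm_le[of "xs @ ys"] foldr_append_mult[of xs ys] conjugates_carrier by auto
qed

lemma word_norm_conj: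
  assumes "g \<in> carrier G" "h \<in> carrier G"
  shows "word_norm G S (h \<otimes> g \<otimes> inv h) \<le> word_norm G S g"
proof -
  obtain xs where xs: "length xs = word_norm G S g" "set xs \<subseteq> conjugates G S"
    "g = foldr (\<otimes>) xs \<one>"
    using word_norm_attained assms by metis
  then have "set (map (\<lambda>c. h \<otimes> c \<otimes> inv h) xs) \<subseteq> conjugates G S"
    using conjugates_conj assms by auto
  from word_norm_le[OF this] show ?thesis
    using xs assms conjugates_carrier by (simp add: foldr_conj)
qed

text \<open>
  Here \<open>a\<close> is fixed while \<open>m\<close> varies: \<open>[m, a]\<close> is a conjugate of \<open>a\<close> times \<open>a\<inverse>\<close>.
\<close>

lemma norm_bounded_commutators:
  assumes "a \<in> carrier G" "M \<subseteq> carrier G"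
  shows "norm_bounded ((\<lambda>m. commutator m a) ` M)"
proof -
  have "word_norm G S (commutator m a) \<le> word_norm G S a + word_norm G S (inv a)"
    if "m \<in> M" for m
  proof -
    have m: "m \<in> carrier G" using that assms by auto
    show ?thesis
      using word_norm_mult[of "m \<otimes> a \<otimes> inv m" "inv a"] word_norm_conj[of a m] m assms by simp
  qed
  then show ?thesis by (intro bdd_aboveI2) (auto simp: image_image)
qed

lemma norm_bounded_mult:
  assumes "norm_bounded U" "norm_bounded V" "U \<subseteq> carrier G" "V \<subseteq> carrier G"
    and "Z \<subseteq> {x \<otimes> y | x y. x \<in> U \<and> y \<in> V}"
  shows "norm_bounded Z"
proof -
  obtain k l where k: "\<And>x. x \<in> U \<Longrightarrow> word_norm G S x \<le> k"
    and l: "\<And>x. x \<in> V \<Longrightarrow> word_norm G S x \<le> l"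
    using assms(1,2) by (auto simp: bdd_above_def)
  have "word_norm G S z \<le> k + l" if z: "z \<in> Z" for z
  proof -
    obtain x y where "x \<in> U" "y \<in> V" "z = x \<otimes> y" using z assms(5) by blast
    then show ?thesis
      using word_norm_mult[of x y] assms(3,4) k[of x] l[of y] by fastforce
  qed
  then show ?thesis by (intro bdd_aboveI2)
qed

lemma norm_bounded_mono: "norm_bounded V \<Longrightarrow> U \<subseteq> V \<Longrightarrow> norm_bounded U"
  by (meson bdd_above_mono image_mono)


section \<open>Passing boundedness up a central series\<close>

text \<open>
  \<open>P\<close> is built by adjoining the commutators with one \<open>a \<in> A\<close> at a time.  The new subgroup consists of the products
  \<open>p [x, a]\<close> with \<open>p \<in> P\<close> and \<open>x \<in> M\<close>, so every step multiplies by a single element of a bounded set.  These products form a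
  subgroup because \<open>x \<mapsto> [x, a]\<close> is a homomorphism modulo \<open>L\<close> and because \<open>K\<close>, being abelian modulo \<open>L\<close>,
  normalises every subgroup between \<open>L\<close> and \<open>K\<close>.
\<close>

lemma bounded_subgroup_with_commutators:
  assumes "finite A" "A \<subseteq> carrier G"
    and L: "subgroup L G" and K: "subgroup K G" and M: "subgroup M G"
    and LK: "L \<subseteq> K" and KM: "K \<subseteq> M"
    and MA: "\<And>m a. m \<in> M \<Longrightarrow> a \<in> A \<Longrightarrow> commutator m a \<in> K"
    and MK: "\<And>m k. m \<in> M \<Longrightarrow> k \<in> K \<Longrightarrow> commutator m k \<in> L"
    and bounded: "norm_bounded L"
  shows "\<exists>P. subgroup P G \<and> L \<subseteq> P \<and> P \<subseteq> K \<and> norm_bounded P \<and>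
             (\<forall>m\<in>M. \<forall>a\<in>A. commutator m a \<in> P)"
  using assms(1,2) MA
proof (induction A rule: finite_induct)
  case empty
  then show ?case using L LK bounded by blast
next
  case (insert a A)
  interpret L: subgroup L G by (fact L)
  interpret K: subgroup K G by (fact K)
  interpret M: subgroup M G by (fact M)
  obtain P where P: "subgroup P G" and LP: "L \<subseteq> P" and PK: "P \<subseteq> K" and bP: "norm_bounded P"
    and comm: "\<And>m a. m \<in> M \<Longrightarrow> a \<in> A \<Longrightarrow> commutator m a \<in> P"
    using insert.IH insert.prems by auto
  interpret P: subgroup P G by (fact P)
  have a: "a \<in> carrier G" using insert.prems by simp
  define f where "f m = commutator m a" for m
  have fK: "f m \<in> K" if "m \<in> M" for m
    using insert.prems(2)[OF that, of a] by (simp add: f_def)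
  have fG: "f m \<in> carrier G" if "m \<in> M" for m
    using fK[OF that] by simp
  define R where "R = {p \<otimes> f x | p x. p \<in> P \<and> x \<in> M}"
  have "subgroup {p \<otimes> f x | p x. p \<in> P \<and> x \<in> carrier (G\<lparr>carrier := M\<rparr>)} G"
  proof (rule subgroup_hom_mod_image[OF P])
    show "group (G\<lparr>carrier := M\<rparr>)" using subgroup_imp_group[OF M] .
  next
    fix x assume "x \<in> carrier (G\<lparr>carrier := M\<rparr>)"
    then show "f x \<in> carrier G" using fG by simp
  next
    fix x p assume "x \<in> carrier (G\<lparr>carrier := M\<rparr>)" and p: "p \<in> P"
    then have x: "x \<in> M" by simp
    have "commutator (f x) p \<in> L"
      using fK[OF x] KM PK p by (intro MK) auto
    then have "commutator (f x) p \<otimes> p \<in> P"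
      using P.m_closed[OF subsetD[OF LP] p] by blast
    then show "f x \<otimes> p \<otimes> inv (f x) \<in> P"
      using p fG[OF x] by (simp add: word_simps)
  next
    fix x y assume "x \<in> carrier (G\<lparr>carrier := M\<rparr>)" "y \<in> carrier (G\<lparr>carrier := M\<rparr>)"
    then have x: "x \<in> M" and y: "y \<in> M" by auto
    \<comment> \<open>The defect of additivity is a product of commutators of \<open>M\<close> with \<open>K\<close>.\<close>
    have "f (x \<otimes> y) = commutator x (f y) \<otimes> f y \<otimes> f x"
      unfolding f_def using commutator_mult_left[of x y a] x y a by simp
    then have "f x \<otimes> f y \<otimes> inv (f (x \<otimes> y)) = commutator (f x) (f y) \<otimes> inv (commutator x (f y))"
      using x y fG[OF x] fG[OF y] by (simp add: word_simps)
    also have "\<dots> \<in> L"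
      by (rule L.m_closed[OF MK L.m_inv_closed[OF MK]]) (use x fK[OF x] fK[OF y] KM in auto)
    finally show "f x \<otimes> f y \<otimes> inv (f (x \<otimes>\<^bsub>G\<lparr>carrier := M\<rparr>\<^esub> y)) \<in> P"
      using LP by auto
  qed
  then have R: "subgroup R G" by (simp add: R_def)
  have f1: "f \<one> = \<one>" using a by (simp add: f_def)
  have PR: "P \<subseteq> R"
  proof
    fix p assume "p \<in> P"
    then have "p = p \<otimes> f \<one>" using f1 P.mem_carrier by simp
    with \<open>p \<in> P\<close> show "p \<in> R"
      unfolding R_def by (intro CollectI exI[of _ p] exI[of _ \<one>]) simp
  qed
  have "R \<subseteq> K" unfolding R_def using PK fK by auto
  moreover have "norm_bounded R"
    by (rule norm_bounded_mult[OF bP norm_bounded_commutators[OF a M.subset]])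
      (use fG in \<open>auto simp: R_def f_def\<close>)
  moreover have "commutator m b \<in> R" if "m \<in> M" "b \<in> insert a A" for m b
  proof (cases "b = a")
    case True
    have "f m = \<one> \<otimes> f m" using fG[OF that(1)] by simp
    with that(1) have "f m \<in> R"
      unfolding R_def by (intro CollectI exI[of _ \<one>] exI[of _ m]) simp
    then show ?thesis by (simp add: f_def True)
  next
    case False
    then show ?thesis using comm that PR by blast
  qed
  ultimately have "subgroup R G \<and> L \<subseteq> R \<and> R \<subseteq> K \<and> norm_bounded R \<and>
      (\<forall>m\<in>M. \<forall>b\<in>insert a A. commutator m b \<in> R)"
    using R order.trans[OF LP PR] by simp
  then show ?case ..
qed

text \<open>
  The subgroup \<open>P\<close> obtained for the finite set \<open>A\<close> captures the commutators with all of \<open>generate G A\<close>, so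
  finite generation turns finitely many bounded sets into a bound on the whole commutator subgroup.
\<close>

lemma norm_bounded_mixed_commutator:
  assumes A: "finite A" "A \<subseteq> carrier G"
    and L: "subgroup L G" and K: "subgroup K G" and M: "subgroup M G"
    and LK: "L \<subseteq> K" and KM: "K \<subseteq> M"
    and MQ: "\<And>m q. m \<in> M \<Longrightarrow> q \<in> generate G A \<Longrightarrow> commutator m q \<in> K"
    and MK: "\<And>m k. m \<in> M \<Longrightarrow> k \<in> K \<Longrightarrow> commutator m k \<in> L"
    and bounded: "norm_bounded L"
  shows "norm_bounded (mixed_commutator G M (generate G A))"
proof -
  obtain P where P: "subgroup P G" "norm_bounded P"
    and comm: "\<And>m a. m \<in> M \<Longrightarrow> a \<in> A \<Longrightarrow> commutator m a \<in> P"
    using bounded_subgroup_with_commutators[OF A L K M LK KM MQ[OF _ generate.incl] MK bounded]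
    by blast
  have "commutator m q \<in> P" if "m \<in> M" "q \<in> generate G A" for m q
    by (rule commutators_in_subgroup_generators[OF P(1) M A(2) KM MQ comm that(2,1)])
  then have "mixed_commutator G M (generate G A) \<subseteq> P"
    unfolding mixed_commutator_def by (intro generate_subgroup_incl[OF _ P(1)]) auto
  then show ?thesis by (rule norm_bounded_mono[OF P(2)])
qed

end

section \<open>Lower central series of a subgroup\<close>

lemma (in group) mixed_commutator_subgroup:
  assumes "H \<subseteq> carrier G" "K \<subseteq> carrier G"
  shows "subgroup (mixed_commutator G H K) G"
  unfolding mixed_commutator_def using assms
  by (intro generate_is_subgroup) (auto simp: subset_iff)

lemma (in group) mixed_commutator_mono:
  assumes "H \<subseteq> H'" "K \<subseteq> K'"
  shows "mixed_commutator G H K \<subseteq> mixed_commutator G H' K'"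
  unfolding mixed_commutator_def using assms by (intro mono_generate) auto

lemma commutator_in_mixed_commutator:
  assumes "h \<in> H" "k \<in> K"
  shows "h \<otimes>\<^bsub>G\<^esub> k \<otimes>\<^bsub>G\<^esub> inv\<^bsub>G\<^esub> h \<otimes>\<^bsub>G\<^esub> inv\<^bsub>G\<^esub> k \<in> mixed_commutator G H K"
  unfolding mixed_commutator_def using assms by (intro generate.incl) auto

lemma (in group) mixed_commutator_consistent:
  assumes N: "subgroup N G" and "H \<subseteq> N" "K \<subseteq> N"
  shows "mixed_commutator (G\<lparr>carrier := N\<rparr>) H K = mixed_commutator G H K"
proof -
  interpret N: subgroup N G by (fact N)
  let ?C = "{h \<otimes> k \<otimes> inv h \<otimes> inv k | h k. h \<in> H \<and> k \<in> K}"
  have inv_eq: "inv\<^bsub>G\<lparr>carrier := N\<rparr>\<^esub> x = inv x" if "x \<in> H \<union> K" for x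
    using that assms m_inv_consistent[OF N] by auto
  have "{h \<otimes>\<^bsub>G\<lparr>carrier := N\<rparr>\<^esub> k \<otimes>\<^bsub>G\<lparr>carrier := N\<rparr>\<^esub> inv\<^bsub>G\<lparr>carrier := N\<rparr>\<^esub> h
      \<otimes>\<^bsub>G\<lparr>carrier := N\<rparr>\<^esub> inv\<^bsub>G\<lparr>carrier := N\<rparr>\<^esub> k | h k. h \<in> H \<and> k \<in> K} = ?C"
    by (intro Collect_cong ex_cong1) (auto simp: inv_eq)
  moreover have "?C \<subseteq> N" using assms by blast
  ultimately show ?thesis
    unfolding mixed_commutator_def using generate_consistent[OF _ N] by simp
qed

lemma (in group) derived_eq_mixed_commutator: "derived G H = mixed_commutator G H H"
  unfolding derived_def mixed_commutator_def by (rule arg_cong[of _ _ "generate G"]) auto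

text \<open>
  The lower central series of \<open>N\<close> as a group in its own right is described inside \<open>G\<close>, where the word norm lives.
\<close>

lemma (in group) lower_central_series_of_subgroup:
  fixes N
  assumes N: "subgroup N G"
  defines "\<gamma> \<equiv> lower_central_series (G\<lparr>carrier := N\<rparr>)"
  shows "subgroup (\<gamma> i) G \<and> \<gamma> (Suc i) \<subseteq> \<gamma> i \<and> \<gamma> i \<subseteq> N
    \<and> \<gamma> (Suc i) = mixed_commutator G (\<gamma> i) N"
proof (induction i)
  case 0
  have 1: "\<gamma> 0 = N" by (simp add: \<gamma>_def)
  have 2: "\<gamma> (Suc 0) = mixed_commutator G N N"
    using mixed_commutator_consistent[OF N] by (simp add: \<gamma>_def)
  show ?case
    using derived_incl[of N, OF _ N] N unfolding 1 2 derived_eq_mixed_commutator by simp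
next
  case (Suc i)
  have sub: "\<gamma> (Suc i) \<subseteq> N" using Suc by blast
  have "N \<subseteq> carrier G" using N by (rule subgroup.subset)
  then have "subgroup (\<gamma> (Suc i)) G"
    using Suc mixed_commutator_subgroup[of "\<gamma> i" N] by auto
  moreover have eq: "\<gamma> (Suc (Suc i)) = mixed_commutator G (\<gamma> (Suc i)) N"
    using mixed_commutator_consistent[OF N sub] by (simp add: \<gamma>_def)
  moreover have "\<gamma> (Suc (Suc i)) \<subseteq> \<gamma> (Suc i)"
    using mixed_commutator_mono[of "\<gamma> (Suc i)" "\<gamma> i" N N] Suc unfolding eq by auto
  ultimately show ?case using sub by blast
qed

section \<open>Boundedness of the commutator subgroup\<close>

lemma (in word_normed_group) norm_bounded_one: "norm_bounded {\<one>}"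
  by simp

text \<open>
  Boundedness climbs the lower central series from the trivial term.  It stops at \<open>\<gamma>\<^sub>1\<close> and cannot reach \<open>N\<close>
  itself, since each step yields a group generated by commutators of \<open>N\<close>.
\<close>

lemma (in word_normed_group) norm_bounded_derived_nilpotent:
  assumes N: "subgroup N G" and fg: "finitely_generated_group (G\<lparr>carrier := N\<rparr>)"
    and nil: "nilpotent_group (G\<lparr>carrier := N\<rparr>)"
  shows "norm_bounded (derived G N)"
proof -
  define \<gamma> where "\<gamma> = lower_central_series (G\<lparr>carrier := N\<rparr>)"
  have sub: "subgroup (\<gamma> i) G" and dec: "\<gamma> (Suc i) \<subseteq> \<gamma> i" and le: "\<gamma> i \<subseteq> N"
    and Suc: "\<gamma> (Suc i) = mixed_commutator G (\<gamma> i) N" for i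
    using lower_central_series_of_subgroup[OF N, of i] unfolding \<gamma>_def by blast+
  interpret N: subgroup N G by (fact N)
  obtain A where A: "finite A" "A \<subseteq> N" and gen: "generate G A = N"
    using fg generate_consistent[OF _ N] unfolding finitely_generated_group_def by auto
  obtain n where n: "\<gamma> n = {\<one>}"
    using nil unfolding nilpotent_group_def \<gamma>_def by auto
  have in_series: "commutator m q \<in> \<gamma> (Suc i)" if "m \<in> \<gamma> i" "q \<in> N" for m q i
    unfolding Suc using that by (rule commutator_in_mixed_commutator)
  have step: "norm_bounded (\<gamma> (Suc i))" if "norm_bounded (\<gamma> (Suc (Suc i)))" for i
  proof -
    have "norm_bounded (mixed_commutator G (\<gamma> i) (generate G A))"
    proof (rule norm_bounded_mixed_commutator[of A "\<gamma> (Suc (Suc i))" "\<gamma> (Suc i)"])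
      show "finite A" "A \<subseteq> carrier G" using A by auto
      show "subgroup (\<gamma> (Suc (Suc i))) G" "subgroup (\<gamma> (Suc i)) G" "subgroup (\<gamma> i) G"
        by (rule sub)+
      show "\<gamma> (Suc (Suc i)) \<subseteq> \<gamma> (Suc i)" "\<gamma> (Suc i) \<subseteq> \<gamma> i"
        by (rule dec)+
      show "norm_bounded (\<gamma> (Suc (Suc i)))" by (fact that)
    next
      fix m q assume "m \<in> \<gamma> i" "q \<in> generate G A"
      then show "commutator m q \<in> \<gamma> (Suc i)" using in_series gen by simp
    next
      fix m k assume m: "m \<in> \<gamma> i" and k: "k \<in> \<gamma> (Suc i)"
      have mN: "m \<in> N" "k \<in> N" using subsetD[OF le] m k by auto
      have "inv (commutator k m) \<in> \<gamma> (Suc (Suc i))"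
        by (rule subgroup.m_inv_closed[OF sub in_series[OF k mN(1)]])
      then show "commutator m k \<in> \<gamma> (Suc (Suc i))"
        using mN by (simp add: word_simps)
    qed
    then show ?thesis by (simp only: gen Suc)
  qed
  \<comment> \<open>Starting at \<open>Suc n\<close> rather than \<open>n\<close> covers the trivial group, where \<open>n\<close> may be 0.\<close>
  have "norm_bounded (\<gamma> (Suc n))"
    using norm_bounded_mono[OF norm_bounded_one] dec[of n] n by simp
  then have "norm_bounded (\<gamma> (Suc 0))"
  proof (induction n)
    case (Suc n)
    from Suc.IH[OF step[OF Suc.prems]] show ?case .
  qed
  moreover have "\<gamma> 0 = N" by (simp add: \<gamma>_def)
  ultimately show ?thesis
    unfolding derived_eq_mixed_commutator using Suc[of 0] by simp
qed

text \<open>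
  The two steps from \<open>[N, N]\<close> to \<open>[N, G]\<close> and from there to \<open>N = [G, G]\<close> use the same layer argument,
  now with a finite generating set of \<open>G\<close>: \<open>N\<close> is abelian modulo \<open>[N, N]\<close>, and it is central in \<open>G\<close> modulo \<open>[N, G]\<close>.
\<close>

lemma (in word_normed_group) norm_bounded_derived:
  assumes fg: "finitely_generated_group G"
    and fgN: "finitely_generated_group (G\<lparr>carrier := derived G (carrier G)\<rparr>)"
    and nil: "nilpotent_group (G\<lparr>carrier := derived G (carrier G)\<rparr>)"
  shows "norm_bounded (derived G (carrier G))"
proof -
  define N where "N = derived G (carrier G)"
  interpret N: normal N G unfolding N_def by (rule derived_self_is_normal)
  have N: "subgroup N G" by (rule N.subgroup_axioms)
  obtain A where A: "finite A" "A \<subseteq> carrier G" and gen: "generate G A = carrier G"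
    using fg unfolding finitely_generated_group_def by auto
  have comm: "commutator x y \<in> N" if "x \<in> carrier G" "y \<in> carrier G" for x y
    unfolding N_def derived_eq_mixed_commutator
    using that by (rule commutator_in_mixed_commutator)
  have derN: "derived G N \<subseteq> N" using derived_incl[OF order.refl N] .
  have "norm_bounded (mixed_commutator G N (generate G A))"
  proof (rule norm_bounded_mixed_commutator
      [OF A derived_is_subgroup[OF N.subset] N N derN order.refl])
    show "norm_bounded (derived G N)"
      by (rule norm_bounded_derived_nilpotent[OF N fgN[folded N_def] nil[folded N_def]])
  next
    fix m q assume "m \<in> N" "q \<in> generate G A"
    then show "commutator m q \<in> N" by (simp add: gen comm)
  next
    fix m k assume "m \<in> N" "k \<in> N"
    then show "commutator m k \<in> derived G N"
      unfolding derived_eq_mixed_commutator by (rule commutator_in_mixed_commutator)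
  qed
  then have bdd: "norm_bounded (mixed_commutator G N (carrier G))" by (simp add: gen)
  have sub: "subgroup (mixed_commutator G N (carrier G)) G"
    using mixed_commutator_subgroup N.subset by simp
  have "norm_bounded (mixed_commutator G (carrier G) (generate G A))"
  proof (rule norm_bounded_mixed_commutator[OF A sub N subgroup_self _ N.subset _ _ bdd])
    show "mixed_commutator G N (carrier G) \<subseteq> N"
      unfolding mixed_commutator_def by (rule generate_subgroup_incl[OF _ N]) (auto simp: comm)
  next
    fix m q assume "m \<in> carrier G" "q \<in> generate G A"
    then show "commutator m q \<in> N" by (simp add: gen comm)
  next
    fix m k assume mk: "m \<in> carrier G" "k \<in> N"
    have "inv (commutator k m) \<in> mixed_commutator G N (carrier G)"
      using mk by (intro subgroup.m_inv_closed[OF sub] commutator_in_mixed_commutator) auto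
    then show "commutator m k \<in> mixed_commutator G N (carrier G)"
      using mk by (simp add: word_simps)
  qed
  then show ?thesis by (simp add: gen derived_eq_mixed_commutator)
qed

section \<open>Homomorphisms to the reals\<close>

definition (in group) additive_on :: "'a set \<Rightarrow> ('a \<Rightarrow> real) \<Rightarrow> bool"
  where "additive_on H q \<longleftrightarrow> (\<forall>x\<in>H. \<forall>y\<in>H. q (x \<otimes> y) = q x + q y)"

lemma (in group) additive_on_int_pow:
  assumes H: "subgroup H G" and q: "additive_on H q" and x: "x \<in> H"
  shows "q (x [^] (n::int)) = of_int n * q x"
proof -
  interpret H: subgroup H G by (fact H)
  have pow: "x [^] k \<in> H" for k :: nat
    using subgroup_int_pow_closed[OF H x, of "int k"] by (simp add: int_pow_int)
  have q1: "q \<one> = 0"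
    using q H.one_closed unfolding additive_on_def by fastforce
  have nat: "q (x [^] k) = of_nat k * q x" for k :: nat
    by (induction k) (use q pow x q1 in \<open>auto simp: additive_on_def algebra_simps\<close>)
  have neg: "q (inv y) = - q y" if "y \<in> H" for y
  proof -
    have "q (inv y \<otimes> y) = q (inv y) + q y"
      using q H.m_inv_closed[OF that] that unfolding additive_on_def by blast
    then show ?thesis using that q1 by simp
  qed
  show ?thesis
    by (cases n rule: int_cases2) (use x pow nat neg in \<open>simp_all add: int_pow_int int_pow_neg\<close>)
qed

text \<open>
  The value \<open>c\<close> at \<open>a\<close> only has to agree with \<open>q\<close> on the powers of \<open>a\<close> that already lie in \<open>H\<close>; then
  \<open>h a\<^sup>n \<mapsto> q h + n c\<close> is well defined.  It is additive because \<open>q\<close> vanishes on commutators and is therefore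
  invariant under conjugation by all of \<open>G\<close>.
\<close>

lemma (in group) extend_additive:
  fixes q :: "'a \<Rightarrow> real"
  assumes H: "subgroup H G" and der: "derived G (carrier G) \<subseteq> H" and a: "a \<in> carrier G"
    and q: "additive_on H q" and q0: "\<And>x. x \<in> derived G (carrier G) \<Longrightarrow> q x = 0"
    and c: "\<And>n::int. a [^] n \<in> H \<Longrightarrow> q (a [^] n) = of_int n * c"
  obtains H' q' where "subgroup H' G" "H \<subseteq> H'" "a \<in> H'" "additive_on H' q'"
    "\<And>x. x \<in> H \<Longrightarrow> q' x = q x" "q' a = c"
proof -
  interpret H: subgroup H G by (fact H)
  define H' where "H' = {h \<otimes> a [^] n | h (n::int). h \<in> H}"
  have conj: "x \<otimes> h \<otimes> inv x \<in> H \<and> q (x \<otimes> h \<otimes> inv x) = q h"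
    if x: "x \<in> carrier G" and h: "h \<in> H" for x h
  proof -
    define d where "d = commutator x h"
    have d: "d \<in> derived G (carrier G)"
      unfolding d_def derived_eq_mixed_commutator using x h
      by (intro commutator_in_mixed_commutator) auto
    have "x \<otimes> h \<otimes> inv x = d \<otimes> h" using x h by (simp add: d_def word_simps)
    moreover have dH: "d \<in> H" using d der by blast
    moreover have "q (d \<otimes> h) = q d + q h" using q dH h unfolding additive_on_def by blast
    ultimately show ?thesis using h q0[OF d] by simp
  qed
  have pow [simp]: "a [^] (n::int) \<in> carrier G" for n using a by simp
  have "subgroup {h \<otimes> a [^] n | h (n::int). h \<in> H \<and> n \<in> carrier integer_group} G"
    by (rule subgroup_hom_mod_image[OF H group_integer_group, where f = "\<lambda>n. a [^] n"])
      (use a conj in \<open>auto simp: int_pow_mult\<close>)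
  then have H': "subgroup H' G" by (simp add: H'_def)
  have qinv: "q (inv x) = - q x" if "x \<in> H" for x
    using additive_on_int_pow[OF H q that, of "- 1"] that by (simp add: int_pow_neg)
  have wd: "q h + of_int n * c = q h' + of_int m * c"
    if h: "h \<in> H" "h' \<in> H" and eq: "h \<otimes> a [^] n = h' \<otimes> a [^] m" for h h' and n m :: int
  proof -
    have "a [^] (m - n) = inv h' \<otimes> h"
    proof -
      have "a [^] (m - n) = inv h' \<otimes> (h' \<otimes> a [^] m) \<otimes> inv (a [^] n)"
        using h a by (simp add: int_pow_diff)
      also have "\<dots> = inv h' \<otimes> h" using h unfolding eq[symmetric] by (simp add: word_simps)
      finally show ?thesis .
    qed
    then have "q (inv h' \<otimes> h) = of_int (m - n) * c" using c[of "m - n"] h by auto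
    moreover have "q (inv h' \<otimes> h) = q h - q h'"
      using q h qinv[OF h(2)] unfolding additive_on_def by auto
    ultimately show ?thesis by (simp add: algebra_simps)
  qed
  have "\<forall>g\<in>H'. \<exists>r. \<forall>h\<in>H. \<forall>n::int. g = h \<otimes> a [^] n \<longrightarrow> r = q h + of_int n * c"
    using wd unfolding H'_def by blast
  then obtain q' where "\<forall>g\<in>H'. \<forall>h\<in>H. \<forall>n::int. g = h \<otimes> a [^] n \<longrightarrow> q' g = q h + of_int n * c"
    by metis
  then have q': "q' (h \<otimes> a [^] n) = q h + of_int n * c" if "h \<in> H" for h and n :: int
    using that unfolding H'_def by blast
  have ext: "q' h = q h" "h \<in> H'" if "h \<in> H" for h
    using q'[OF that, of 0] that unfolding H'_def by (auto intro!: exI[of _ h] exI[of _ 0])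
  have q1: "q \<one> = 0" using additive_on_int_pow[OF H q, of \<one> 0] by simp
  have qa: "q' a = c" "a \<in> H'"
    using q'[of \<one> 1] q1 a unfolding H'_def by (auto intro!: exI[of _ \<one>] exI[of _ 1])
  have "additive_on H' q'"
    unfolding additive_on_def
  proof (intro ballI)
    fix x y assume "x \<in> H'" "y \<in> H'"
    then obtain h k and n m :: int where h: "h \<in> H" "k \<in> H"
      and xy: "x = h \<otimes> a [^] n" "y = k \<otimes> a [^] m"
      unfolding H'_def by blast
    let ?k = "a [^] n \<otimes> k \<otimes> inv (a [^] n)"
    have k: "?k \<in> H" "q ?k = q k" using conj[of "a [^] n" k] h by auto
    have "x \<otimes> y = (h \<otimes> ?k) \<otimes> a [^] (n + m)"
      using h a xy by (simp add: word_simps int_pow_mult)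
    then have "q' (x \<otimes> y) = q (h \<otimes> ?k) + of_int (n + m) * c"
      using q'[of "h \<otimes> ?k" "n + m"] h k by simp
    also have "q (h \<otimes> ?k) = q h + q k" using q h k unfolding additive_on_def by auto
    finally show "q' (x \<otimes> y) = q' x + q' y"
      using q'[OF h(1)] q'[OF h(2)] xy by (simp add: algebra_simps)
  qed
  then show ?thesis using that H' ext qa by blast
qed

text \<open>
  A compatible value at \<open>a\<close> always exists: if some \<open>a\<^sup>k\<close> with \<open>k \<noteq> 0\<close> lies in \<open>H\<close>, divide \<open>q (a\<^sup>k)\<close> by \<open>k\<close>;
  otherwise there is no condition.  The exponent \<open>k\<close> need not be minimal, as \<open>q (a\<^sup>n\<^sup>k)\<close> can be computed
  from \<open>a\<^sup>n\<close> and from \<open>a\<^sup>k\<close>.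
\<close>

lemma (in group) extend_additive_exists:
  fixes q :: "'a \<Rightarrow> real"
  assumes H: "subgroup H G" and der: "derived G (carrier G) \<subseteq> H" and a: "a \<in> carrier G"
    and q: "additive_on H q" and q0: "\<And>x. x \<in> derived G (carrier G) \<Longrightarrow> q x = 0"
  obtains H' q' where "subgroup H' G" "H \<subseteq> H'" "a \<in> H'" "additive_on H' q'"
    "\<And>x. x \<in> H \<Longrightarrow> q' x = q x"
proof -
  have "\<exists>c. \<forall>n::int. a [^] n \<in> H \<longrightarrow> q (a [^] n) = of_int n * c"
  proof (cases "\<exists>k::int. k \<noteq> 0 \<and> a [^] k \<in> H")
    case True
    then obtain k :: int where k: "k \<noteq> 0" "a [^] k \<in> H" by blast
    have "q (a [^] n) = of_int n * (q (a [^] k) / of_int k)" if n: "a [^] n \<in> H" for n :: int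
    proof -
      have "of_int k * q (a [^] n) = q (a [^] (n * k))"
        using additive_on_int_pow[OF H q n, of k] a by (simp add: int_pow_pow)
      also have "\<dots> = of_int n * q (a [^] k)"
        using additive_on_int_pow[OF H q k(2), of n] a by (simp add: int_pow_pow mult.commute)
      finally show ?thesis using k(1) by (simp add: field_simps)
    qed
    then show ?thesis by blast
  next
    case False
    have "q \<one> = 0" using q subgroup.one_closed[OF H] unfolding additive_on_def by fastforce
    then show ?thesis using False by (intro exI[of _ 0]) (auto, metis int_pow_0)
  qed
  then obtain c where "\<And>n::int. a [^] n \<in> H \<Longrightarrow> q (a [^] n) = of_int n * c" by blast
  from extend_additive[OF H der a q q0 this] show ?thesis using that by metis
qed

text \<open>
  The hypothesis says that \<open>g\<close> has infinite order in the abelianization.  Hence the value 1 at \<open>g\<close> is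
  compatible with the value 0 on the commutator subgroup, and this homomorphism extends over a finite generating set.
\<close>

lemma (in group) exists_additive_nonzero:
  assumes fg: "finitely_generated_group G" and g: "g \<in> carrier G"
    and inf: "\<And>n::int. g [^] n \<in> derived G (carrier G) \<Longrightarrow> n = 0"
  obtains q where "additive_on (carrier G) q" "q g \<noteq> 0"
proof -
  let ?N = "derived G (carrier G)"
  obtain A where A: "finite A" "A \<subseteq> carrier G" and gen: "generate G A = carrier G"
    using fg unfolding finitely_generated_group_def by auto
  have "\<exists>H q. subgroup H G \<and> ?N \<subseteq> H \<and> A \<subseteq> H \<and> additive_on H q \<and> (\<forall>x\<in>?N. q x = 0) \<and>
          g \<in> H \<and> q g = 1"
    using A
  proof (induction A rule: finite_induct)
    case empty
    have "additive_on ?N (\<lambda>_. 0)" by (simp add: additive_on_def)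
    moreover have "(0::real) = of_int n * 1" if "g [^] n \<in> ?N" for n :: int
      using inf[OF that] by simp
    ultimately obtain H q where "subgroup H G" "?N \<subseteq> H" "g \<in> H" "additive_on H q"
      "\<And>x. x \<in> ?N \<Longrightarrow> q x = 0" "q g = 1"
      using extend_additive[OF derived_is_subgroup[OF order.refl] order.refl g, of "\<lambda>_. 0" 1]
      by metis
    then show ?case by blast
  next
    case (insert a A)
    then obtain H q where H: "subgroup H G" "?N \<subseteq> H" "A \<subseteq> H" "additive_on H q"
      "\<And>x. x \<in> ?N \<Longrightarrow> q x = 0" "g \<in> H" "q g = 1" by auto
    have a: "a \<in> carrier G" using insert.prems by simp
    obtain H' q' where H': "subgroup H' G" "H \<subseteq> H'" "a \<in> H'" "additive_on H' q'"
      "\<And>x. x \<in> H \<Longrightarrow> q' x = q x"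
      using extend_additive_exists[OF H(1,2) a H(4,5)] by blast
    show ?case
      by (rule exI[of _ H'], rule exI[of _ q']) (use H H' in auto)
  qed
  then obtain H q where H: "subgroup H G" "A \<subseteq> H" "additive_on H q" "q g = 1" by blast
  have "H = carrier G"
    using generate_subgroup_incl[OF H(2,1)] gen subgroup.subset[OF H(1)] by auto
  then show ?thesis using that H by auto
qed

lemma (in group) additive_imp_homogeneous_quasimorphism:
  assumes "additive_on (carrier G) q"
  shows "homogeneous_quasimorphism G q"
  unfolding homogeneous_quasimorphism_def
  using assms additive_on_int_pow[OF subgroup_self assms]
  by (auto simp: additive_on_def intro!: exI[of _ 0])

section \<open>Boundedness of cyclic subgroups and the dichotomy\<close>

text \<open>
  Division with remainder writes each power of \<open>g\<close> as a power of \<open>g\<^sup>n\<close>, which lies in \<open>N\<close>, times one of finitely many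
  remaining powers.
\<close>

lemma (in word_normed_group) norm_bounded_cyclic:
  assumes N: "subgroup N G" and bdd: "norm_bounded N" and g: "g \<in> carrier G"
    and n: "n \<noteq> 0" "g [^] (n::int) \<in> N"
  shows "norm_bounded (generate G {g})"
proof (rule norm_bounded_mult[OF bdd])
  \<comment> \<open>The symmetric range contains all remainders for either sign of \<open>n\<close>.\<close>
  let ?R = "(\<lambda>i. g [^] i) ` {- \<bar>n\<bar>..\<bar>n\<bar>}"
  show "norm_bounded ?R" by (intro bdd_above_finite) simp
  show "N \<subseteq> carrier G" using N by (rule subgroup.subset)
  show "?R \<subseteq> carrier G" using g by auto
  show "generate G {g} \<subseteq> {x \<otimes> y | x y. x \<in> N \<and> y \<in> ?R}"
  proof
    fix x assume "x \<in> generate G {g}"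
    then obtain k :: int where x: "x = g [^] k" using generate_pow[OF g] by auto
    have "x = g [^] (n * (k div n) + k mod n)" by (simp add: x)
    also have "\<dots> = (g [^] n) [^] (k div n) \<otimes> g [^] (k mod n)"
      using g by (simp only: int_pow_mult int_pow_pow)
    finally have "x = (g [^] n) [^] (k div n) \<otimes> g [^] (k mod n)" .
    moreover have "(g [^] n) [^] (k div n) \<in> N"
      using subgroup_int_pow_closed[OF N n(2)] .
    moreover have "k mod n \<in> {- \<bar>n\<bar>..\<bar>n\<bar>}"
      using abs_mod_less[OF n(1), of k] by auto
    ultimately show "x \<in> {x \<otimes> y | x y. x \<in> N \<and> y \<in> ?R}" by blast
  qed
qed

lemma (in group) finitely_generated_imp_normally:
  assumes "finitely_generated_group G"
  shows "normally_finitely_generated G"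
proof -
  obtain A where A: "finite A" "A \<subseteq> carrier G" and gen: "generate G A = carrier G"
    using assms unfolding finitely_generated_group_def by auto
  let ?S = "A \<union> m_inv G ` A"
  have S: "?S \<subseteq> carrier G" using A by auto
  have sub: "?S \<subseteq> conjugates G ?S"
  proof
    fix s assume s: "s \<in> ?S"
    then have "s = \<one> \<otimes> s \<otimes> inv \<one>" using S by auto
    then show "s \<in> conjugates G ?S" unfolding conjugates_def using s by blast
  qed
  have "conjugates G ?S \<subseteq> carrier G" using S unfolding conjugates_def by auto
  then have "generate G (conjugates G ?S) = carrier G"
    using generate_incl mono_generate[of A "conjugates G ?S"] sub gen by blast
  then have "normal_generating_set G ?S"
    using A S unfolding normal_generating_set_def by auto
  then show ?thesis unfolding normally_finitely_generated_def using group_axioms by blast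
qed

theorem theorem5p11:
  fixes G :: "('a, 'b) monoid_scheme"
  assumes "group G"
    and "finitely_generated_group G"
    and "solvable G"
    and "finitely_generated_group (G\<lparr>carrier := derived G (carrier G)\<rparr>)"
    and "nilpotent_group (G\<lparr>carrier := derived G (carrier G)\<rparr>)"
  shows "bounded_subgroup G (derived G (carrier G)) \<and> bq_dichotomy G"
proof -
  interpret group G by (fact assms(1))
  let ?N = "derived G (carrier G)"
  have nfg: "normally_finitely_generated G"
    using finitely_generated_imp_normally[OF assms(2)] .
  have N: "subgroup ?N G" using derived_is_subgroup[OF order.refl] .
  have bdd: "bdd_above (word_norm G S ` ?N)" if "normal_generating_set G S" for S
  proof -
    interpret word_normed_group G S by unfold_locales (fact that)
    show ?thesis using norm_bounded_derived[OF assms(2,4,5)] .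
  qed
  have "bounded_subgroup G (generate G {g}) \<or>
      (\<exists>q. homogeneous_quasimorphism G q \<and> q g \<noteq> 0)" if g: "g \<in> carrier G" for g
  proof (cases "\<exists>n::int. n \<noteq> 0 \<and> g [^]\<^bsub>G\<^esub> n \<in> ?N")
    case True
    then obtain n :: int where n: "n \<noteq> 0" "g [^]\<^bsub>G\<^esub> n \<in> ?N" by blast
    have "bdd_above (word_norm G S ` generate G {g})" if S: "normal_generating_set G S" for S
    proof -
      interpret word_normed_group G S by unfold_locales (fact S)
      show ?thesis using norm_bounded_cyclic[OF N bdd[OF S] g n] .
    qed
    then have "bounded_subgroup G (generate G {g})"
      unfolding bounded_subgroup_def using nfg generate_is_subgroup[of "{g}"] g by auto
    then show ?thesis ..
  next
    case False
    then obtain q where "additive_on (carrier G) q" "q g \<noteq> 0"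
      using exists_additive_nonzero[OF assms(2) g] by blast
    then show ?thesis using additive_imp_homogeneous_quasimorphism by blast
  qed
  then have "bq_dichotomy G"
    unfolding bq_dichotomy_def using nfg by blast
  moreover have "bounded_subgroup G ?N"
    unfolding bounded_subgroup_def using nfg N bdd by blast
  ultimately show ?thesis by blast
qed

end
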